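(* Let $a,\sigma>0$ and $\theta\ge 0$ be constants, and let $\nu$ be a Lévy measure concentrated on $(0,\infty)$ with $\int_{(0,\infty)}(\xi\wedge 1)\,\nu(d\xi)<\infty$. For $x\ge 0$ let $(X^x_t)_{t\ge 0}$ be the jump-diffusion CIR (JCIR) process started from $x$, i.e. the unique strong solution of $$dX^x_t=a(\theta-X^x_t)\,dt+\sigma\sqrt{X^x_t}\,dW_t+dJ_t,\qquad X^x_0=x,$$ where $W$ is a one-dimensional Brownian motion and $J$ is an independent pure-jump Lévy process with Lévy measure $\nu$. Assume that $$\int_{(1,\infty)}\xi\,\nu(d\xi)<\infty\quad\text{and}\quad\int_{(0,1)}\xi\ln\Big(\frac1\xi\Big)\,\nu(d\xi)<\infty .$$ Let $\pi$ be the unique invariant probability measure of the JCIR process, and let $P^t(x,\cdot):=P(X^x_t\in\cdot)$. Then the JCIR process is exponentially ergodic: there exist constants $0<\beta<1$ and $0<B<\infty$ such that $$\|P^t(x,\cdot)-\pi\|_{TV}\le B(x+1)\beta^t\qquad\text{for all } t\ge 0,\ x\in\mathbb{R}_+ .$$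
   Context: All processes live on a filtered probability space $(\Omega,\mathcal F,(\mathcal F_t)_{t\ge0},P)$. The pure-jump Lévy process $J$ has only positive jumps, no drift and no Gaussian part, i.e. $E[e^{uJ_t}]=\exp\big(t\int_{(0,\infty)}(e^{u\xi}-1)\nu(d\xi)\big)$ for $\Re u\le 0$. The stochastic differential equation has a unique strong solution, which stays in $\mathbb{R}_+=[0,\infty)$ for every starting point $x\ge0$. Its law is characterized by $$E[e^{uX^x_t}]=\Big(1-\tfrac{\sigma^2}{2a}u(1-e^{-at})\Big)^{-2a\theta/\sigma^2}\exp\big(x\psi(t,u)\big)\exp\Big(\int_0^t\int_{(0,\infty)}\big(e^{\xi\psi(s,u)}-1\big)\nu(d\xi)\,ds\Big),\quad \Re u\le0,$$ with $\psi(t,u)=\dfrac{ue^{-at}}{1-\frac{\sigma^2}{2a}u(1-e^{-at})}$ (principal branch of the power). Under $\int_{(1,\infty)}\xi\,\nu(d\xi)<\infty$ it is known that the JCIR process has a unique invariant probability measure $\pi$ on $\mathbb{R}_+$, i.e. a unique probability measure with $\int_{\mathbb{R}_+} P^t(x,A)\,\pi(dx)=\pi(A)$ for all $t\ge0$ and $A\in\mathcal B(\mathbb{R}_+)$. The total-variation norm of a signed measure $\mu$ on $\mathbb{R}_+$ is $\|\mu\|_{TV}=\sup_{A\in\mathcal B(\mathbb{R}_+)}|\mu(A)|$. *)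

theory Defs
  imports "HOL-Probability.Probability"
begin

section \<open>Filtered probability spaces and driving noises\<close>

text \<open>Time is \<open>[0, \<infinity>)\<close>, encoded by reals with guards; values of processes and filtrations
  at negative times are irrelevant. The usual conditions are not required.\<close>

definition filtered_prob_space :: "'a measure \<Rightarrow> (real \<Rightarrow> 'a measure) \<Rightarrow> bool" where
  "filtered_prob_space M F \<longleftrightarrow>
     prob_space M \<and>
     (\<forall>t\<ge>0. subalgebra M (F t)) \<and>
     (\<forall>s\<ge>0. \<forall>t\<ge>s. sets (F s) \<subseteq> sets (F t))"

definition adapted :: "(real \<Rightarrow> 'a measure) \<Rightarrow> (real \<Rightarrow> 'a \<Rightarrow> real) \<Rightarrow> bool" where
  "adapted F Y \<longleftrightarrow> (\<forall>t\<ge>0. Y t \<in> borel_measurable (F t))"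

definition progressive :: "(real \<Rightarrow> 'a measure) \<Rightarrow> (real \<Rightarrow> 'a \<Rightarrow> real) \<Rightarrow> bool" where
  "progressive F Y \<longleftrightarrow>
     (\<forall>t\<ge>0. (\<lambda>(s, \<omega>). Y s \<omega>) \<in> borel_measurable (restrict_space borel {0..t} \<Otimes>\<^sub>M F t))"

definition cadlag :: "(real \<Rightarrow> real) \<Rightarrow> bool" where
  "cadlag f \<longleftrightarrow>
     (\<forall>t\<ge>0. (f \<longlongrightarrow> f t) (at_right t)) \<and>
     (\<forall>t>0. \<exists>l. (f \<longlongrightarrow> l) (at_left t))"

definition preimages :: "'a measure \<Rightarrow> ('a \<Rightarrow> real) \<Rightarrow> 'a set set" where
  "preimages M Z = {Z -` A \<inter> space M | A. A \<in> sets borel}"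

definition indep_increments :: "'a measure \<Rightarrow> (real \<Rightarrow> 'a measure) \<Rightarrow> (real \<Rightarrow> 'a \<Rightarrow> real) \<Rightarrow> bool" where
  "indep_increments M F Y \<longleftrightarrow>
     (\<forall>s\<ge>0. \<forall>t\<ge>s. prob_space.indep_set M (sets (F s)) (preimages M (\<lambda>\<omega>. Y t \<omega> - Y s \<omega>)))"

definition brownian_motion :: "'a measure \<Rightarrow> (real \<Rightarrow> 'a measure) \<Rightarrow> (real \<Rightarrow> 'a \<Rightarrow> real) \<Rightarrow> bool" where
  "brownian_motion M F W \<longleftrightarrow>
     adapted F W \<and>
     (AE \<omega> in M. W 0 \<omega> = 0) \<and>
     (AE \<omega> in M. continuous_on {0..} (\<lambda>t. W t \<omega>)) \<and>
     indep_increments M F W \<and>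
     (\<forall>s\<ge>0. \<forall>t>s. distributed M lborel (\<lambda>\<omega>. W t \<omega> - W s \<omega>) (normal_density 0 (sqrt (t - s))))"

definition levy_measure :: "real measure \<Rightarrow> bool" where
  "levy_measure \<nu> \<longleftrightarrow>
     sets \<nu> = sets borel \<and> emeasure \<nu> {0} = 0 \<and> (\<integral>\<^sup>+ \<xi>. ennreal (min 1 (\<xi>\<^sup>2)) \<partial>\<nu>) < \<infinity>"

definition levy_process :: "'a measure \<Rightarrow> (real \<Rightarrow> 'a measure) \<Rightarrow> (real \<Rightarrow> 'a \<Rightarrow> real) \<Rightarrow> bool" where
  "levy_process M F J \<longleftrightarrow>
     adapted F J \<and>
     (AE \<omega> in M. J 0 \<omega> = 0) \<and>
     (AE \<omega> in M. cadlag (\<lambda>t. J t \<omega>)) \<and>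
     indep_increments M F J \<and>
     (\<forall>s\<ge>0. \<forall>t\<ge>s. distr M borel (\<lambda>\<omega>. J t \<omega> - J s \<omega>) = distr M borel (J (t - s)))"

text \<open>The exponent fixes zero drift, zero Gaussian part and positive jumps only.
  Its right-hand side never vanishes, so the integral on the left is never the
  default value of a non-integrable function.\<close>

definition pure_jump_levy_process ::
    "'a measure \<Rightarrow> (real \<Rightarrow> 'a measure) \<Rightarrow> real measure \<Rightarrow> (real \<Rightarrow> 'a \<Rightarrow> real) \<Rightarrow> bool" where
  "pure_jump_levy_process M F \<nu> J \<longleftrightarrow>
     levy_process M F J \<and>
     (\<forall>t\<ge>0. \<forall>u::complex. Re u \<le> 0 \<longrightarrow>
        (LINT \<omega>|M. exp (u * of_real (J t \<omega>))) =
        exp (of_real t * (LINT \<xi>:{0<..}|\<nu>. exp (u * of_real \<xi>) - 1)))"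

definition generated_sets :: "'a measure \<Rightarrow> (real \<Rightarrow> 'a \<Rightarrow> real) \<Rightarrow> 'a set set" where
  "generated_sets M Y = sigma_sets (space M) (\<Union>t\<in>{0..}. preimages M (Y t))"

definition indep_processes ::
    "'a measure \<Rightarrow> (real \<Rightarrow> 'a \<Rightarrow> real) \<Rightarrow> (real \<Rightarrow> 'a \<Rightarrow> real) \<Rightarrow> bool" where
  "indep_processes M Y Z \<longleftrightarrow> prob_space.indep_set M (generated_sets M Y) (generated_sets M Z)"

section \<open>The It\^o integral\<close>

text \<open>A simple process with \<open>n\<close> steps is
  \<open>H\<^sub>s = \<Sum>i<n. \<xi>\<^sub>i 1\<^bsub>(\<tau>\<^sub>i, \<tau>\<^sub>i\<^sub>+\<^sub>1]\<^esub>(s)\<close> with deterministic times and bounded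
  \<open>\<xi>\<^sub>i\<close> measurable at time \<open>\<tau>\<^sub>i\<close>.\<close>

definition simple_process ::
    "'a measure \<Rightarrow> (real \<Rightarrow> 'a measure) \<Rightarrow> nat \<Rightarrow> (nat \<Rightarrow> real) \<Rightarrow> (nat \<Rightarrow> 'a \<Rightarrow> real) \<Rightarrow> bool" where
  "simple_process M F n \<tau> \<xi> \<longleftrightarrow>
     0 \<le> \<tau> 0 \<and> (\<forall>i<n. \<tau> i \<le> \<tau> (Suc i)) \<and>
     (\<forall>i<n. \<xi> i \<in> borel_measurable (F (\<tau> i)) \<and> (\<exists>C. \<forall>\<omega>\<in>space M. \<bar>\<xi> i \<omega>\<bar> \<le> C))"

definition simple_value ::
    "nat \<Rightarrow> (nat \<Rightarrow> real) \<Rightarrow> (nat \<Rightarrow> 'a \<Rightarrow> real) \<Rightarrow> real \<Rightarrow> 'a \<Rightarrow> real" where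
  "simple_value n \<tau> \<xi> s \<omega> = (\<Sum>i<n. \<xi> i \<omega> * indicator {\<tau> i<..\<tau> (Suc i)} s)"

definition simple_integral ::
    "(real \<Rightarrow> 'a \<Rightarrow> real) \<Rightarrow> nat \<Rightarrow> (nat \<Rightarrow> real) \<Rightarrow> (nat \<Rightarrow> 'a \<Rightarrow> real) \<Rightarrow> real \<Rightarrow> 'a \<Rightarrow> real" where
  "simple_integral W n \<tau> \<xi> t \<omega> =
     (\<Sum>i<n. \<xi> i \<omega> * (W (min t (\<tau> (Suc i))) \<omega> - W (min t (\<tau> i)) \<omega>))"

text \<open>\<open>I\<close> is (a version of) \<open>\<integral>\<^sub>0\<^sup>t H\<^sub>s dW\<^sub>s\<close> for progressive \<open>H\<close> with
  \<open>\<integral>\<^sub>0\<^sup>t H\<^sub>s\<^sup>2 ds < \<infinity>\<close> almost surely: the almost surely continuous process which at each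
  time is the limit in probability of the integrals of simple processes \<open>H\<^sup>k\<close> with
  \<open>\<integral>\<^sub>0\<^sup>t (H\<^sup>k\<^sub>s - H\<^sub>s)\<^sup>2 ds \<rightarrow> 0\<close> in probability.  All events below are measurable
  by progressivity, so no probability takes a default value.\<close>

definition ito_integral ::
    "'a measure \<Rightarrow> (real \<Rightarrow> 'a measure) \<Rightarrow> (real \<Rightarrow> 'a \<Rightarrow> real) \<Rightarrow>
     (real \<Rightarrow> 'a \<Rightarrow> real) \<Rightarrow> (real \<Rightarrow> 'a \<Rightarrow> real) \<Rightarrow> bool" where
  "ito_integral M F W H I \<longleftrightarrow>
     progressive F H \<and>
     (AE \<omega> in M. \<forall>t\<ge>0. (\<integral>\<^sup>+ s\<in>{0..t}. ennreal ((H s \<omega>)\<^sup>2) \<partial>lborel) < \<infinity>) \<and>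
     (\<forall>t\<ge>0. I t \<in> borel_measurable M) \<and>
     (AE \<omega> in M. continuous_on {0..} (\<lambda>t. I t \<omega>)) \<and>
     (\<exists>n \<tau> \<xi>.
        (\<forall>k. simple_process M F (n k) (\<tau> k) (\<xi> k)) \<and>
        (\<forall>t\<ge>0. \<forall>\<epsilon>>0.
           (\<lambda>k. measure M {\<omega> \<in> space M. ennreal \<epsilon> <
              (\<integral>\<^sup>+ s\<in>{0..t}. ennreal ((simple_value (n k) (\<tau> k) (\<xi> k) s \<omega> - H s \<omega>)\<^sup>2) \<partial>lborel)})
           \<longlonglongrightarrow> 0) \<and>
        (\<forall>t\<ge>0. \<forall>\<epsilon>>0.
           (\<lambda>k. measure M {\<omega> \<in> space M.
              \<epsilon> < \<bar>simple_integral W (n k) (\<tau> k) (\<xi> k) t \<omega> - I t \<omega>\<bar>})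
           \<longlonglongrightarrow> 0))"

section \<open>The JCIR process\<close>

definition jcir_solution ::
    "'a measure \<Rightarrow> (real \<Rightarrow> 'a measure) \<Rightarrow> real \<Rightarrow> real \<Rightarrow> real \<Rightarrow>
     (real \<Rightarrow> 'a \<Rightarrow> real) \<Rightarrow> (real \<Rightarrow> 'a \<Rightarrow> real) \<Rightarrow> real \<Rightarrow> (real \<Rightarrow> 'a \<Rightarrow> real) \<Rightarrow> bool" where
  "jcir_solution M F a \<theta> \<sigma> W J x X \<longleftrightarrow>
     adapted F X \<and>
     (AE \<omega> in M. cadlag (\<lambda>t. X t \<omega>)) \<and>
     (AE \<omega> in M. \<forall>t\<ge>0. 0 \<le> X t \<omega>) \<and>
     (\<exists>I. ito_integral M F W (\<lambda>s \<omega>. sqrt (X s \<omega>)) I \<and>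
        (AE \<omega> in M. \<forall>t\<ge>0.
           X t \<omega> = x + (LINT s:{0..t}|lborel. a * (\<theta> - X s \<omega>)) + \<sigma> * I t \<omega> + J t \<omega>))"

definition jcir_psi :: "real \<Rightarrow> real \<Rightarrow> real \<Rightarrow> complex \<Rightarrow> complex" where
  "jcir_psi a \<sigma> t u =
     u * of_real (exp (- a * t)) / (1 - of_real (\<sigma>\<^sup>2 / (2 * a)) * u * of_real (1 - exp (- a * t)))"

text \<open>The affine transform formula. The base of the power has real part at least 1
  when \<open>Re u \<le> 0\<close>; \<open>powr\<close> on complex numbers is the principal branch.\<close>

definition jcir_transform ::
    "real \<Rightarrow> real \<Rightarrow> real \<Rightarrow> real measure \<Rightarrow> real \<Rightarrow> real \<Rightarrow> complex \<Rightarrow> complex" where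
  "jcir_transform a \<theta> \<sigma> \<nu> t x u =
     (1 - of_real (\<sigma>\<^sup>2 / (2 * a)) * u * of_real (1 - exp (- a * t))) powr of_real (- (2 * a * \<theta> / \<sigma>\<^sup>2))
     * exp (of_real x * jcir_psi a \<sigma> t u)
     * exp (LINT s:{0..t}|lborel. (LINT \<xi>:{0<..}|\<nu>. exp (of_real \<xi> * jcir_psi a \<sigma> s u) - 1))"

text \<open>\<open>P\<^sup>t(x, \<cdot>)\<close> as a measure on the Borel sets of \<open>[0, \<infinity>)\<close>. Restricting loses no mass,
  since the solution is almost surely nonnegative.\<close>

definition transition_kernel ::
    "'a measure \<Rightarrow> (real \<Rightarrow> real \<Rightarrow> 'a \<Rightarrow> real) \<Rightarrow> real \<Rightarrow> real \<Rightarrow> real measure" where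
  "transition_kernel M X t x = restrict_space (distr M borel (X x t)) {0..}"

definition invariant_prob_measure :: "(real \<Rightarrow> real \<Rightarrow> real measure) \<Rightarrow> real measure \<Rightarrow> bool" where
  "invariant_prob_measure P \<pi> \<longleftrightarrow>
     prob_space \<pi> \<and> sets \<pi> = sets (restrict_space borel {0..}) \<and>
     (\<forall>t\<ge>0. \<forall>A\<in>sets \<pi>. (\<integral>\<^sup>+ x. emeasure (P t x) A \<partial>\<pi>) = emeasure \<pi> A)"

text \<open>Total-variation norm of a finite signed measure on \<open>[0, \<infinity>)\<close>, the latter given as a
  set function.\<close>

definition tv_norm :: "(real set \<Rightarrow> real) \<Rightarrow> real" where
  "tv_norm \<mu> = (SUP A\<in>sets (restrict_space borel {0..}). \<bar>\<mu> A\<bar>)"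

end

theory Submission
  imports Defs
begin

text \<open>
  The process is affine, and the starting point \<open>x\<close> enters its transform only through the factor
  \<open>exp (x * \<psi>(t, u))\<close>. For \<open>t > 0\<close> this factor is the transform of a compound Poisson law with rate
  \<open>x * branching_rate a \<sigma> t\<close> and exponential jumps (\<open>jcir_transform_change_start\<close>). So for \<open>x \<le> y\<close> the
  process started from \<open>y\<close> has at time \<open>t\<close> the law of the one started from \<open>x\<close> plus an independent
  compound Poisson variable, which vanishes with probability at least
  \<open>1 - branching_rate a \<sigma> t * (y - x)\<close>. Therefore the total variation distance of \<open>P\<^sup>t(x, \<cdot>)\<close> and
  \<open>P\<^sup>t(y, \<cdot>)\<close> is at most \<open>branching_rate a \<sigma> t * \<bar>x - y\<bar>\<close>, and the rate is of order
  \<open>exp (- a * t)\<close> (\<open>jcir_law_lipschitz\<close>).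

  Averaging this over \<open>y\<close> with respect to \<open>\<pi>\<close> gives, by invariance, the bound
  \<open>branching_rate a \<sigma> t * (x + m)\<close> for the distance of \<open>P\<^sup>t(x, \<cdot>)\<close> and \<open>\<pi>\<close>, where \<open>m\<close> is the mean of
  \<open>\<pi>\<close> (\<open>tv_norm_invariant_le\<close>). Times \<open>t < 1\<close> are covered by the trivial bound \<open>1\<close>.

  It remains to see that \<open>m\<close> is finite. The transform at \<open>u = - q < 0\<close> is at least
  \<open>exp (- q * (K + x * exp (- a * t)))\<close> with \<open>K = \<theta> + (\<integral>\<xi> d\<nu>) / a\<close>
  (\<open>jcir_laplace_lower_bound\<close>), and \<open>K\<close> is finite because the jumps have finite mean. Integrating over \<open>\<pi>\<close>
  and letting \<open>t\<close> tend to infinity bounds the Laplace transform of \<open>\<pi>\<close> below by \<open>exp (- q * K)\<close>, and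
  letting \<open>q\<close> tend to \<open>0\<close> bounds the mean by \<open>K\<close> (\<open>invariant_measure_integrable\<close>).
\<close>

section \<open>Compound Poisson perturbations\<close>

lemma real_distribution_convolution:
  assumes "real_distribution M" "real_distribution N"
  shows "real_distribution (M \<star> N)"
proof -
  interpret M: real_distribution M by fact
  interpret N: real_distribution N by fact
  interpret P: pair_prob_space M N ..
  have "prob_space (M \<star> N)"
    unfolding convolution_def by (rule P.prob_space_distr) simp
  then show ?thesis
    by (simp add: real_distribution_def real_distribution_axioms_def)
qed

lemma char_convolution:
  assumes "real_distribution M" "real_distribution N"
  shows "char (M \<star> N) t = char M t * char N t"
proof -
  interpret M: real_distribution M by fact
  interpret N: real_distribution N by fact
  interpret P: pair_prob_space M N ..
  have "integrable (M \<Otimes>\<^sub>M N) (\<lambda>p. iexp (t * (fst p + snd p)))"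
    by (intro P.integrable_iexp) simp_all
  then have int: "integrable (M \<Otimes>\<^sub>M N) (\<lambda>(x, y). iexp (t * (x + y)))"
    by (simp add: split_beta')
  have "char (M \<star> N) t = (CLINT p|M \<Otimes>\<^sub>M N. (case p of (x, y) \<Rightarrow> iexp (t * (x + y))))"
    by (simp add: char_def convolution_def integral_distr split_beta')
  also have "\<dots> = (CLINT x|M. CLINT y|N. iexp (t * (x + y)))"
    using P.integral_fst'[OF int] by simp
  also have "\<dots> = (CLINT x|M. CLINT y|N. iexp (t * x) * iexp (t * y))"
    by (simp add: exp_add[symmetric] algebra_simps)
  also have "\<dots> = char M t * char N t"
    by (simp add: char_def)
  finally show ?thesis .
qed

lemma integral_poisson_pmf_power:
  fixes z :: complex
  assumes r: "r > 0" and z: "norm z \<le> 1"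
  shows "(LINT n|measure_pmf (poisson_pmf r). z ^ n) = exp (of_real r * (z - 1))"
proof -
  have eq: "pmf (poisson_pmf r) n *\<^sub>R z ^ n
      = exp (- of_real r) * ((of_real r * z) ^ n /\<^sub>R fact n)" for n
    using r by (simp add: scaleR_conv_of_real power_mult_distrib exp_of_real[symmetric] field_simps)
  have "integrable (measure_pmf (poisson_pmf r)) (\<lambda>n. z ^ n)"
    by (rule measure_pmf.integrable_const_bound[where B=1])
       (auto simp: norm_power z power_le_one)
  then have "integrable (count_space UNIV) (\<lambda>n. pmf (poisson_pmf r) n *\<^sub>R z ^ n)"
    by (simp add: measure_pmf_eq_density integrable_density)
  from sums_integral_count_space_nat[OF this]
  have "(\<lambda>n. pmf (poisson_pmf r) n *\<^sub>R z ^ n) sums (LINT n|measure_pmf (poisson_pmf r). z ^ n)"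
    by (simp add: measure_pmf_eq_density integral_density)
  moreover have "(\<lambda>n. pmf (poisson_pmf r) n *\<^sub>R z ^ n) sums (exp (- of_real r) * exp (of_real r * z))"
    unfolding eq by (intro sums_mult exp_converges)
  ultimately have "(LINT n|measure_pmf (poisson_pmf r). z ^ n) = exp (- of_real r) * exp (of_real r * z)"
    by (rule sums_unique2)
  also have "\<dots> = exp (of_real r * (z - 1))"
    by (simp add: exp_add[symmetric] algebra_simps)
  finally show ?thesis .
qed

lemma real_distributions_measurable_pmf:
  assumes K: "\<And>n. real_distribution (K n)"
  shows "K \<in> measure_pmf p \<rightarrow>\<^sub>M subprob_algebra borel"
  using K
  by (auto simp: measurable_pmf_measure1 space_subprob_algebra
    intro!: prob_space_imp_subprob_space
    dest: real_distribution.axioms(1) real_distribution.events_eq_borel)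

lemma char_bind_pmf:
  assumes K: "\<And>n. real_distribution (K n)"
  shows "real_distribution (measure_pmf p \<bind> K)"
    and "char (measure_pmf p \<bind> K) t = (LINT n|measure_pmf p. char (K n) t)"
proof -
  note meas = real_distributions_measurable_pmf[OF K]
  have one: "emeasure (K n) (space (K n)) \<le> ennreal 1" for n
    using prob_space.emeasure_space_1[OF real_distribution.axioms(1)[OF K]] by simp
  have prob: "prob_space (measure_pmf p \<bind> K)"
    by (rule measure_pmf.prob_space_bind[OF _ meas]) (simp add: real_distribution.axioms(1)[OF K])
  have sets: "sets (measure_pmf p \<bind> K) = sets borel"
    by (rule sets_bind_measurable[OF meas]) simp
  show "real_distribution (measure_pmf p \<bind> K)"
    using prob sets by (simp add: real_distribution_def real_distribution_axioms_def)
  interpret B: real_distribution "measure_pmf p \<bind> K" by fact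
  have int: "integrable M f" if "prob_space M" "sets M = sets borel" "f \<in> borel_measurable borel" 
    "\<And>x. norm (f x) \<le> 1" for f :: "real \<Rightarrow> complex" and M
  proof -
    interpret prob_space M by fact
    have "f \<in> borel_measurable M" using that by (simp cong: measurable_cong_sets)
    then show ?thesis by (intro integrable_const_bound[where B=1]) (auto simp: that)
  qed
  let ?f = "\<lambda>x. iexp (t * x)"
  have f: "?f \<in> borel_measurable borel" by measurable
  have intb: "integrable (measure_pmf p \<bind> K) ?f"
    by (rule int[OF prob sets f]) simp
  have intK: "integrable (K n) ?f" for n
    by (rule int[OF real_distribution.axioms(1)[OF K] real_distribution.events_eq_borel[OF K] f]) simp
  have intC: "integrable (measure_pmf p) (\<lambda>n. char (K n) t)"
    by (rule measure_pmf.integrable_const_bound[where B=1])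
       (auto simp: real_distribution.cmod_char_le_1[OF K])
  have bnd: "\<bar>Re (?f x)\<bar> \<le> 1" "\<bar>Im (?f x)\<bar> \<le> 1" for x
    using abs_Re_le_cmod[of "?f x"] abs_Im_le_cmod[of "?f x"] by (simp_all del: Re_exp Im_exp)
  have "Re (char (measure_pmf p \<bind> K) t) = (LINT x|(measure_pmf p \<bind> K). Re (?f x))"
    unfolding char_def by (rule integral_Re[OF intb, symmetric])
  also have "\<dots> = (LINT n|measure_pmf p. LINT x|K n. Re (?f x))"
    by (rule integral_bind[OF _ bnd(1) meas _ AE_I2[OF one]]) (use f in \<open>auto intro: measure_pmf.finite_measure_axioms\<close>)
  also have "\<dots> = (LINT n|measure_pmf p. Re (char (K n) t))"
    unfolding char_def by (simp only: integral_Re[OF intK])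
  also have "\<dots> = Re (LINT n|measure_pmf p. char (K n) t)"
    by (rule integral_Re[OF intC])
  finally have re: "Re (char (measure_pmf p \<bind> K) t) = Re (LINT n|measure_pmf p. char (K n) t)" .
  have "Im (char (measure_pmf p \<bind> K) t) = (LINT x|(measure_pmf p \<bind> K). Im (?f x))"
    unfolding char_def by (rule integral_Im[OF intb, symmetric])
  also have "\<dots> = (LINT n|measure_pmf p. LINT x|K n. Im (?f x))"
    by (rule integral_bind[OF _ bnd(2) meas _ AE_I2[OF one]]) (use f in \<open>auto intro: measure_pmf.finite_measure_axioms\<close>)
  also have "\<dots> = (LINT n|measure_pmf p. Im (char (K n) t))"
    unfolding char_def by (simp only: integral_Im[OF intK])
  also have "\<dots> = Im (LINT n|measure_pmf p. char (K n) t)"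
    by (rule integral_Im[OF intC])
  finally have im: "Im (char (measure_pmf p \<bind> K) t) = Im (LINT n|measure_pmf p. char (K n) t)" .
  show "char (measure_pmf p \<bind> K) t = (LINT n|measure_pmf p. char (K n) t)"
    using re im by (rule complex_eqI)
qed

text \<open>Adding to an \<open>M\<close>-distributed variable an independent compound Poisson sum with rate \<open>r\<close> and
  jump law \<open>N\<close> multiplies the characteristic function by \<open>exp (r * (char N - 1))\<close>. The sum is
  empty with probability \<open>exp (- r)\<close>, so the law moves by at most \<open>1 - exp (- r) \<le> r\<close> in
  total variation.\<close>

lemma compound_poisson_perturbation:
  assumes M: "real_distribution M" and N: "real_distribution N" and r: "r \<ge> 0"
  obtains R where "real_distribution R"
    and "\<And>t. char R t = char M t * exp (of_real r * (char N t - 1))"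
    and "\<And>A. A \<in> sets borel \<Longrightarrow> \<bar>measure R A - measure M A\<bar> \<le> r"
proof (cases "r = 0")
  case True
  show ?thesis by (rule that[of M]) (simp_all add: M True)
next
  case False
  with r have r: "r > 0" by simp
  \<comment> \<open>\<open>K n\<close> is the law of an \<open>M\<close>-variable plus \<open>n\<close> independent \<open>N\<close>-variables; starting the
    recursion at \<open>M\<close> instead of the point mass at \<open>0\<close> saves a final convolution.\<close>
  define K where "K = rec_nat M (\<lambda>_ L. (L \<star> N))"
  have K0: "K 0 = M" and KS: "K (Suc n) = (K n \<star> N)" for n by (simp_all add: K_def)
  have K: "real_distribution (K n)" for n
    by (induction n) (simp_all add: K0 KS M N real_distribution_convolution)
  have charK: "char (K n) t = char M t * char N t ^ n" for n t
    by (induction n) (simp_all add: K0 KS char_convolution K N mult_ac)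
  define R where "R = (measure_pmf (poisson_pmf r) \<bind> K)"
  have R: "real_distribution R" unfolding R_def by (rule char_bind_pmf[OF K])
  interpret M: real_distribution M by fact
  interpret R: real_distribution R by fact
  have charR: "char R t = char M t * exp (of_real r * (char N t - 1))" for t
    unfolding R_def char_bind_pmf(2)[OF K] charK
    by (simp add: integral_poisson_pmf_power[OF r real_distribution.cmod_char_le_1[OF N]])
  have lower: "measure M A - r \<le> measure R A" if A: "A \<in> sets borel" for A
  proof -
    note meas = real_distributions_measurable_pmf[OF K]
    \<comment> \<open>On the event that the Poisson number of summands is \<open>0\<close> the law \<open>M\<close> is unchanged.\<close>
    have "ennreal (exp (- r) * measure M A) = ennreal (pmf (poisson_pmf r) 0) * emeasure (K 0) A"
      using r by (simp add: K0 M.emeasure_eq_measure ennreal_mult)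
    also have "\<dots> = (\<integral>\<^sup>+n. emeasure (K 0) A * indicator {0} n \<partial>measure_pmf (poisson_pmf r))"
      by (subst nn_integral_cmult_indicator) (simp_all add: emeasure_pmf_single mult.commute)
    also have "\<dots> \<le> (\<integral>\<^sup>+n. emeasure (K n) A \<partial>measure_pmf (poisson_pmf r))"
      by (intro nn_integral_mono) (simp split: split_indicator)
    also have "\<dots> = ennreal (measure R A)"
      unfolding R_def[symmetric] R.emeasure_eq_measure[symmetric] unfolding R_def
      by (rule emeasure_bind[OF _ meas A, symmetric]) simp
    finally have "exp (- r) * measure M A \<le> measure R A" by simp
    moreover have "(1 - r) * measure M A \<le> exp (- r) * measure M A"
      using exp_ge_add_one_self[of "-r"] by (intro mult_right_mono) auto
    moreover have "r * measure M A \<le> r * 1"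
      using r by (intro mult_left_mono) auto
    ultimately show ?thesis by (simp add: algebra_simps)
  qed
  \<comment> \<open>The upper bound is the lower bound for the complement.\<close>
  have "\<bar>measure R A - measure M A\<bar> \<le> r" if A: "A \<in> sets borel" for A
    using lower[OF A] lower[of "UNIV - A"] A M.prob_compl[of A] R.prob_compl[of A] by simp
  with R charR show ?thesis by (rule that)
qed

lemma char_exponential_distribution:
  assumes l: "l > 0"
  shows "char (density lborel (exponential_density l)) s = of_real l / (of_real l - \<i> * of_real s)"
proof -
  \<comment> \<open>The integrand is \<open>l * exp (w * x)\<close> on the half line, with \<open>Re w = - l < 0\<close>.\<close>
  define w where "w = \<i> * of_real s - of_real l"
  have minus_w: "- w = of_real l - \<i> * of_real s" by (simp add: w_def)
  have w0: "w \<noteq> 0" using l by (auto simp: w_def complex_eq_iff)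
  define f where "f x = indicator {0..} x *\<^sub>R (of_real l * exp (w * of_real x))" for x :: real
  have nf: "norm (f x) = exponential_density l x" for x
    using l by (auto simp: f_def exponential_density_def norm_mult w_def split: split_indicator)
  have "integrable lborel (exponential_density l)"
    using l by (intro integrableI_nonneg)
      (auto simp: exponential_density_nonneg nn_integral_erlang_ith_moment[where i=0, simplified])
  then have int: "integrable lborel f"
  proof (rule Bochner_Integration.integrable_bound)
    show "f \<in> borel_measurable lborel" unfolding f_def by measurable
    show "AE x in lborel. norm (f x) \<le> norm (exponential_density l x)" by (simp add: nf)
  qed
  have "char (density lborel (exponential_density l)) s
      = (LINT x|lborel. exponential_density l x *\<^sub>R iexp (s * x))"
    unfolding char_def using l by (subst integral_density) (simp_all add: exponential_density_nonneg)
  also have "\<dots> = (LINT x|lborel. f x)"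
  proof (intro Bochner_Integration.integral_cong refl)
    fix x :: real
    have "exp (w * of_real x) = of_real (exp (- x * l)) * iexp (s * x)"
      by (simp add: w_def exp_of_real[symmetric] exp_add[symmetric] algebra_simps)
    then show "exponential_density l x *\<^sub>R iexp (s * x) = f x"
      by (simp add: f_def exponential_density_def scaleR_conv_of_real)
  qed
  finally have eq: "char (density lborel (exponential_density l)) s = (LINT x|lborel. f x)" .
  have "((\<lambda>y. LINT x|lborel. indicator {..y} x *\<^sub>R f x) \<longlongrightarrow> (LINT x|lborel. f x)) at_top"
    by (rule tendsto_integral_at_top[OF _ int]) simp
  moreover have "eventually (\<lambda>y. (LINT x|lborel. indicator {..y} x *\<^sub>R f x)
      = of_real l / w * exp (w * of_real y) - of_real l / w) at_top"
    using eventually_ge_at_top[of 0]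
  proof eventually_elim
    case (elim y)
    have "(LINT x|lborel. indicator {..y} x *\<^sub>R f x)
        = (LINT x|lborel. indicator {0..y} x *\<^sub>R (of_real l * exp (w * of_real x)))"
      by (intro Bochner_Integration.integral_cong) (auto simp: f_def split: split_indicator)
    also have "\<dots> = of_real l / w * exp (w * of_real y) - of_real l / w * exp (w * of_real 0)"
      using elim w0
      by (intro integral_FTC_Icc has_vector_derivative_real_field)
         (auto intro!: derivative_eq_intros continuous_intros)
    finally show ?case by simp
  qed
  ultimately have "((\<lambda>y. of_real l / w * exp (w * of_real y) - of_real l / w) \<longlongrightarrow> (LINT x|lborel. f x)) at_top"
    by (rule Lim_transform_eventually)
  moreover have "((\<lambda>y. of_real l / w * exp (w * of_real y) - of_real l / w) \<longlongrightarrow> of_real l / w * 0 - of_real l / w) at_top"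
  proof -
    have "filterlim (\<lambda>y::real. - l * y) at_bot at_top"
      by (rule filterlim_tendsto_neg_mult_at_bot[OF tendsto_const _ filterlim_ident]) (use l in simp)
    from filterlim_compose[OF exp_at_bot this]
    have "((\<lambda>y::real. norm (exp (w * of_real y))) \<longlongrightarrow> 0) at_top" by (simp add: w_def)
    then have "((\<lambda>y::real. exp (w * of_real y)) \<longlongrightarrow> 0) at_top" by (rule tendsto_norm_zero_cancel)
    then show ?thesis by (intro tendsto_intros)
  qed
  ultimately have "(LINT x|lborel. f x) = of_real l / w * 0 - of_real l / w"
    by (intro tendsto_unique[of at_top]) simp_all
  also have "\<dots> = of_real l / (of_real l - \<i> * of_real s)"
    unfolding minus_w[symmetric] by simp
  finally show ?thesis using eq by simp
qed

section \<open>Dependence of the JCIR law on the starting point\<close>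

text \<open>In branching terms, \<open>branching_rate a \<sigma> t\<close> is the Poisson rate, per unit of initial mass, of the
  families that are still alive at time \<open>t\<close>. It decays like \<open>exp (- a * t)\<close>.\<close>

definition branching_rate :: "real \<Rightarrow> real \<Rightarrow> real \<Rightarrow> real" where
  "branching_rate a \<sigma> t = exp (- a * t) / (\<sigma>\<^sup>2 / (2 * a) * (1 - exp (- a * t)))"

text \<open>The starting point enters the transform only through \<open>exp (x * \<psi>)\<close>. With
  \<open>m = \<sigma>\<^sup>2 / (2 * a) * (1 - exp (- a * t))\<close>, the exponent is
  \<open>\<psi> = exp (- a * t) * u / (1 - m * u) = branching_rate a \<sigma> t * (1 / (1 - m * u) - 1)\<close>, and
  \<open>1 / (1 - m * u)\<close> is the transform of the exponential law with mean \<open>m\<close>. Hence raising the start from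
  \<open>x\<close> to \<open>y \<ge> x\<close> adds an independent compound Poisson sum of exponential variables.\<close>

lemma jcir_transform_change_start:
  fixes a \<sigma> t x y s :: real
  assumes "a > 0" "\<sigma> > 0" "t > 0"
  defines "m \<equiv> \<sigma>\<^sup>2 / (2 * a) * (1 - exp (- a * t))"
  shows "jcir_transform a \<theta> \<sigma> \<nu> t y (\<i> * of_real s) =
    jcir_transform a \<theta> \<sigma> \<nu> t x (\<i> * of_real s)
    * exp (of_real ((y - x) * branching_rate a \<sigma> t)
           * (char (density lborel (exponential_density (1 / m))) s - 1))"
proof -
  have m: "m > 0" using assms by (simp add: m_def)
  define d where "d = 1 - \<i> * of_real (s * m)"
  have d0: "d \<noteq> 0" by (auto simp: d_def complex_eq_iff)
  have char: "char (density lborel (exponential_density (1 / m))) s = 1 / d"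
  proof -
    have "of_real (1 / m) - \<i> * of_real s = of_real (1 / m) * d"
      using m by (simp add: d_def field_simps)
    then show ?thesis using m d0 by (simp add: char_exponential_distribution)
  qed
  have psi: "jcir_psi a \<sigma> t (\<i> * of_real s) = \<i> * of_real s * of_real (exp (- a * t)) / d"
    by (simp add: jcir_psi_def d_def m_def mult_ac)
  have rate: "branching_rate a \<sigma> t = exp (- a * t) / m"
    by (simp add: branching_rate_def m_def)
  have "1 / d - 1 = \<i> * of_real (s * m) / d"
    using d0 by (simp add: d_def divide_simps)
  then have "of_real (branching_rate a \<sigma> t) * (1 / d - 1) = jcir_psi a \<sigma> t (\<i> * of_real s)"
    unfolding psi rate using m by simp
  then have "of_real y * jcir_psi a \<sigma> t (\<i> * of_real s) = of_real x * jcir_psi a \<sigma> t (\<i> * of_real s)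
     + of_real ((y - x) * branching_rate a \<sigma> t) * (1 / d - 1)"
    by (metis (no_types, opaque_lifting) add.commute diff_add_cancel distrib_right mult.assoc of_real_add of_real_mult)
  then show ?thesis
    unfolding char by (simp add: jcir_transform_def exp_add)
qed

text \<open>The two laws differ by a compound Poisson perturbation of rate
  \<open>branching_rate a \<sigma> t * (y - x)\<close>; uniqueness of characteristic functions identifies the law from \<open>y\<close>
  with the perturbed one. This is where the exponential rate of the theorem comes from.\<close>

lemma jcir_law_lipschitz:
  fixes X Y :: "'a \<Rightarrow> real"
  assumes M: "prob_space M" and [measurable]: "X \<in> borel_measurable M" "Y \<in> borel_measurable M"
    and par: "a > 0" "\<sigma> > 0" "t > 0"
    and X: "\<And>u. Re u \<le> 0 \<Longrightarrow> (LINT \<omega>|M. exp (u * of_real (X \<omega>))) = jcir_transform a \<theta> \<sigma> \<nu> t x u"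
    and Y: "\<And>u. Re u \<le> 0 \<Longrightarrow> (LINT \<omega>|M. exp (u * of_real (Y \<omega>))) = jcir_transform a \<theta> \<sigma> \<nu> t y u"
    and xy: "x \<le> y" and A: "A \<in> sets borel"
  shows "\<bar>measure (distr M borel Y) A - measure (distr M borel X) A\<bar> \<le> branching_rate a \<sigma> t * (y - x)"
proof -
  interpret prob_space M by fact
  define m where "m = \<sigma>\<^sup>2 / (2 * a) * (1 - exp (- a * t))"
  let ?N = "density lborel (exponential_density (1 / m))"
  have m: "m > 0" using par by (simp add: m_def)
  have N: "real_distribution ?N"
    using prob_space_exponential_density[of "1 / m"] m
    by (simp add: real_distribution_def real_distribution_axioms_def)
  have DX: "real_distribution (distr M borel X)" and DY: "real_distribution (distr M borel Y)"
    by (simp_all add: real_distribution_distr)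
  have rate: "0 \<le> (y - x) * branching_rate a \<sigma> t"
    using par xy by (simp add: branching_rate_def)
  have charX: "char (distr M borel X) s = jcir_transform a \<theta> \<sigma> \<nu> t x (\<i> * of_real s)" for s
    using X[of "\<i> * of_real s"] by (simp add: char_def integral_distr mult.assoc)
  have charY: "char (distr M borel Y) s = jcir_transform a \<theta> \<sigma> \<nu> t y (\<i> * of_real s)" for s
    using Y[of "\<i> * of_real s"] by (simp add: char_def integral_distr mult.assoc)
  obtain R where R: "real_distribution R"
    and charR: "\<And>s. char R s = char (distr M borel X) s
      * exp (of_real ((y - x) * branching_rate a \<sigma> t) * (char ?N s - 1))"
    and dist: "\<And>A. A \<in> sets borel \<Longrightarrow>
      \<bar>measure R A - measure (distr M borel X) A\<bar> \<le> (y - x) * branching_rate a \<sigma> t"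
    using compound_poisson_perturbation[OF DX N rate] by metis
  have "char (distr M borel Y) = char R"
    by (rule ext) (simp only: charX charY charR m_def
      jcir_transform_change_start[OF par, where x = x and y = y])
  then have "distr M borel Y = R" by (rule Levy_uniqueness[OF DY R])
  with dist[OF A] show ?thesis by (simp add: mult.commute)
qed

lemma set_integral_exp_minus_le:
  fixes a :: real
  assumes "a > 0" "t \<ge> 0"
  shows "set_integrable lborel {0..t} (\<lambda>s. exp (- a * s))"
    and "(LINT s:{0..t}|lborel. exp (- a * s)) \<le> 1 / a"
proof -
  show "set_integrable lborel {0..t} (\<lambda>s. exp (- a * s))"
    by (rule borel_integrable_atLeastAtMost') (intro continuous_intros)
  have "(LINT s:{0..t}|lborel. exp (- a * s)) = - exp (- a * t) / a - (- exp (- a * 0) / a)"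
    unfolding set_lebesgue_integral_def using assms
    by (intro integral_FTC_Icc)
      (auto intro!: derivative_eq_intros continuous_intros simp: has_real_derivative_iff_has_vector_derivative[symmetric])
  then show "(LINT s:{0..t}|lborel. exp (- a * s)) \<le> 1 / a"
    using assms by (simp add: divide_right_mono)
qed

text \<open>The bound is the one that Jensen's inequality would give, with the mean of the law
  overestimated. Each of the three factors of the transform is estimated separately, using \<open>ln D \<le> D - 1\<close> for the power, \<open>- \<psi>(s, - q) \<le> q * exp (- a * s)\<close>
  and \<open>1 - exp (- v) \<le> v\<close> for the jump part.\<close>

lemma jcir_laplace_lower_bound:
  fixes a \<sigma> \<theta> q x t :: real
  assumes par: "a > 0" "\<sigma> > 0" "\<theta> \<ge> 0" and q: "q > 0" and t: "t \<ge> 0" and x: "x \<ge> 0"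
    and int: "set_integrable \<nu> {0<..} (\<lambda>\<xi>. \<xi>)"
  shows "exp (- q * (\<theta> + (LINT \<xi>:{0<..}|\<nu>. \<xi>) / a + x * exp (- a * t)))
    \<le> Re (jcir_transform a \<theta> \<sigma> \<nu> t x (- of_real q))"
proof -
  define c where "c = \<sigma>\<^sup>2 / (2 * a)"
  have c: "c > 0" using par by (simp add: c_def)
  define k where "k = 2 * a * \<theta> / \<sigma>\<^sup>2"
  have kc: "k * c = \<theta>" using par by (simp add: k_def c_def)
  have k: "k \<ge> 0" using par by (simp add: k_def)
  \<comment> \<open>\<open>D s\<close> is the base of the power and \<open>- p s\<close> is \<open>\<psi>(s, - q)\<close>; both are real at \<open>u = - q\<close>.\<close>
  define D where "D s = 1 + c * q * (1 - exp (- a * s))" for s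
  have D: "D s \<ge> 1" "D s - 1 \<le> c * q" if "s \<ge> 0" for s
    using par q c that by (auto simp: D_def intro!: mult_left_le)
  define p where "p s = q * exp (- a * s) / D s" for s
  have p: "0 \<le> p s" "p s \<le> q * exp (- a * s)" if "s \<ge> 0" for s
    using D(1)[OF that] q divide_left_mono[of 1 "D s" "q * exp (- a * s)"] by (simp_all add: p_def)
  have psi: "jcir_psi a \<sigma> s (- of_real q) = of_real (- p s)" for s
    by (simp add: jcir_psi_def p_def D_def c_def mult_ac)
  define m1 where "m1 = (LINT \<xi>:{0<..}|\<nu>. \<xi>)"
  define g where "g s = (LINT \<xi>:{0<..}|\<nu>. exp (\<xi> * (- p s)) - 1)" for s
  have g: "- g s \<le> q * exp (- a * s) * m1" if s: "s \<ge> 0" for s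
  proof -
    have "- g s = (LINT \<xi>|\<nu>. indicator {0<..} \<xi> *\<^sub>R (1 - exp (\<xi> * (- p s))))"
      unfolding g_def set_lebesgue_integral_def
      by (subst Bochner_Integration.integral_minus[symmetric]) (simp add: algebra_simps)
    \<comment> \<open>Only the dominating function has to be integrable: if the left integrand were not, its
      integral would be \<open>0\<close>.\<close>
    also have "\<dots> \<le> (LINT \<xi>|\<nu>. q * exp (- a * s) * (indicator {0<..} \<xi> *\<^sub>R \<xi>))"
    proof (rule integral_mono')
      show "integrable \<nu> (\<lambda>\<xi>. q * exp (- a * s) * (indicator {0<..} \<xi> *\<^sub>R \<xi>))"
        using int by (simp add: set_integrable_def)
      fix \<xi> :: real
      show "0 \<le> q * exp (- a * s) * (indicator {0<..} \<xi> *\<^sub>R \<xi>)"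
        using q by (simp split: split_indicator)
      show "indicator {0<..} \<xi> *\<^sub>R (1 - exp (\<xi> * (- p s))) \<le> q * exp (- a * s) * (indicator {0<..} \<xi> *\<^sub>R \<xi>)"
      proof (cases "\<xi> > 0")
        case True
        have "1 - exp (\<xi> * (- p s)) \<le> p s * \<xi>"
          using exp_ge_add_one_self[of "\<xi> * (- p s)"] by (simp add: mult.commute)
        also have "\<dots> \<le> q * exp (- a * s) * \<xi>"
          using p[OF s] True by (intro mult_right_mono) auto
        finally show ?thesis using True by simp
      qed simp
    qed
    also have "\<dots> = q * exp (- a * s) * m1"
      by (simp add: m1_def set_lebesgue_integral_def)
    finally show ?thesis .
  qed
  have m1: "m1 \<ge> 0"
    unfolding m1_def set_lebesgue_integral_def by (intro integral_nonneg_AE AE_I2) (simp split: split_indicator)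
  define G where "G = (LINT s:{0..t}|lborel. g s)"
  have "- G \<le> q * m1 * (LINT s:{0..t}|lborel. exp (- a * s))"
  proof -
    have "- G = (LINT s|lborel. - (indicator {0..t} s *\<^sub>R g s))"
      unfolding G_def set_lebesgue_integral_def by simp
    also have "\<dots> \<le> (LINT s|lborel. q * m1 * (indicator {0..t} s *\<^sub>R exp (- a * s)))"
    proof (rule integral_mono')
      show "integrable lborel (\<lambda>s. q * m1 * (indicator {0..t} s *\<^sub>R exp (- a * s)))"
        using set_integral_exp_minus_le(1)[OF par(1) t] by (simp add: set_integrable_def)
    qed (use g q m1 in \<open>auto simp: mult_ac split: split_indicator\<close>)
    finally show ?thesis by (simp add: set_lebesgue_integral_def)
  qed
  also have "\<dots> \<le> q * m1 * (1 / a)"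
    using q m1 set_integral_exp_minus_le(2)[OF par(1) t] by (intro mult_left_mono) auto
  finally have G: "- q * (m1 / a) \<le> G" by simp
  have "jcir_transform a \<theta> \<sigma> \<nu> t x (- of_real q) =
      of_real (D t) powr of_real (- k) * exp (of_real x * of_real (- p t))
      * exp (LINT s:{0..t}|lborel. (LINT \<xi>:{0<..}|\<nu>. exp (of_real \<xi> * of_real (- p s)) - 1))"
    unfolding jcir_transform_def psi by (simp add: D_def k_def c_def)
  also have "of_real (D t) powr of_real (- k) = complex_of_real (D t powr (- k))"
    using D(1)[OF t] by (intro powr_of_real) simp
  also have "(LINT s:{0..t}|lborel. (LINT \<xi>:{0<..}|\<nu>. exp (of_real \<xi> * of_real (- p s)) - 1)) = complex_of_real G"
  proof -
    have "(LINT \<xi>:{0<..}|\<nu>. exp (of_real \<xi> * of_real (- p s)) - 1) = complex_of_real (g s)" for s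
      unfolding g_def set_integral_complex_of_real[symmetric]
      by (simp only: of_real_mult[symmetric] exp_of_real of_real_diff of_real_1)
    then show ?thesis unfolding G_def by (simp only: set_integral_complex_of_real)
  qed
  finally have "jcir_transform a \<theta> \<sigma> \<nu> t x (- of_real q) = of_real (D t powr (- k) * exp (x * (- p t)) * exp G)"
    by (simp only: of_real_mult exp_of_real[symmetric])
  then have eq: "Re (jcir_transform a \<theta> \<sigma> \<nu> t x (- of_real q)) = D t powr (- k) * exp (x * (- p t)) * exp G"
    by simp
  have "k * ln (D t) \<le> k * (c * q)"
    using ln_le_minus_one[of "D t"] D[OF t] k by (intro mult_left_mono) auto
  also have "\<dots> = q * \<theta>" using kc by (metis mult.assoc mult.commute)
  finally have "k * ln (D t) \<le> q * \<theta>" .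
  moreover have "x * p t \<le> x * (q * exp (- a * t))"
    using p[OF t] x by (intro mult_left_mono) auto
  ultimately have "- q * (\<theta> + m1 / a + x * exp (- a * t)) \<le> - k * ln (D t) + x * (- p t) + G"
    using G by (simp add: algebra_simps)
  then have "exp (- q * (\<theta> + m1 / a + x * exp (- a * t))) \<le> exp (- k * ln (D t) + x * (- p t) + G)"
    by simp
  also have "\<dots> = D t powr (- k) * exp (x * (- p t)) * exp G"
    using D(1)[OF t] by (simp add: exp_add[symmetric] powr_def)
  finally show ?thesis unfolding eq m1_def .
qed

section \<open>Invariant measures of kernels on the half line\<close>

text \<open>Since \<open>(1 - exp (- q * z)) / q\<close> tends to \<open>z\<close> as \<open>q\<close> tends to \<open>0\<close>, and has integral at most
  \<open>(1 - exp (- q * K)) / q \<le> K\<close>, Fatou's lemma bounds the mean by \<open>K\<close>.\<close>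

lemma integrable_of_laplace_lower_bound:
  fixes \<pi> :: "real measure"
  assumes "prob_space \<pi>" and [measurable]: "(\<lambda>z. z) \<in> borel_measurable \<pi>"
    and nonneg: "\<And>z. z \<in> space \<pi> \<Longrightarrow> 0 \<le> z" and K: "K \<ge> 0"
    and lap: "\<And>q. q > 0 \<Longrightarrow> exp (- q * K) \<le> (LINT z|\<pi>. exp (- q * z))"
  shows "integrable \<pi> (\<lambda>z. z)"
proof -
  interpret prob_space \<pi> by fact
  define h where "h n = inverse (real (Suc n))" for n
  have h: "h n > 0" for n by (simp add: h_def)
  have lim: "(\<lambda>n. (1 - exp (- h n * z)) / h n) \<longlonglongrightarrow> z" for z
  proof -
    have "((\<lambda>u. 1 - exp (- u * z)) has_real_derivative z) (at 0)"
      by (auto intro!: derivative_eq_intros)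
    then have "((\<lambda>u. (1 - exp (- u * z)) / u) \<longlongrightarrow> z) (at 0)"
      by (simp add: has_field_derivative_iff)
    moreover have "filterlim h (at 0) sequentially"
      unfolding h_def by (rule filterlim_atI[OF LIMSEQ_inverse_real_of_nat]) simp
    ultimately show ?thesis by (rule filterlim_compose)
  qed
  have "(\<integral>\<^sup>+z. ennreal z \<partial>\<pi>) = (\<integral>\<^sup>+z. liminf (\<lambda>n. ennreal ((1 - exp (- h n * z)) / h n)) \<partial>\<pi>)"
    by (intro nn_integral_cong lim_imp_Liminf[symmetric] tendsto_ennrealI lim) simp
  also have "\<dots> \<le> liminf (\<lambda>n. \<integral>\<^sup>+z. ennreal ((1 - exp (- h n * z)) / h n) \<partial>\<pi>)"
    by (rule nn_integral_liminf) simp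
  also have "\<dots> \<le> liminf (\<lambda>n::nat. ennreal K)"
  proof (intro Liminf_mono always_eventually allI)
    fix n
    have int: "integrable \<pi> (\<lambda>z. exp (- h n * z))"
      using h[of n] nonneg by (intro integrable_const_bound[where B=1]) auto
    have "(\<integral>\<^sup>+z. ennreal ((1 - exp (- h n * z)) / h n) \<partial>\<pi>) = ennreal (LINT z|\<pi>. (1 - exp (- h n * z)) / h n)"
      using int h[of n] nonneg by (intro nn_integral_eq_integral) auto
    also have "(LINT z|\<pi>. (1 - exp (- h n * z)) / h n) = (1 - (LINT z|\<pi>. exp (- h n * z))) / h n"
      using int by (simp add: prob_space)
    also have "\<dots> \<le> K"
      using lap[OF h[of n]] exp_ge_add_one_self[of "- h n * K"] h[of n] by (simp add: divide_le_eq mult.commute)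
    finally show "(\<integral>\<^sup>+z. ennreal ((1 - exp (- h n * z)) / h n) \<partial>\<pi>) \<le> ennreal K"
      by (simp add: ennreal_leI)
  qed
  finally have "(\<integral>\<^sup>+z. ennreal z \<partial>\<pi>) < \<infinity>"
    by (simp add: Liminf_const le_less_trans[OF _ ennreal_less_top])
  then show ?thesis
    using nonneg by (intro integrableI_nonneg) auto
qed

text \<open>This supplies the measurability in the starting point of the transition probabilities.\<close>

lemma lipschitz_half_line_measurable:
  fixes f :: "real \<Rightarrow> real"
  assumes L: "L \<ge> 0" and lip: "\<And>x y. 0 \<le> x \<Longrightarrow> 0 \<le> y \<Longrightarrow> \<bar>f x - f y\<bar> \<le> L * \<bar>x - y\<bar>"
  shows "f \<in> borel_measurable (restrict_space borel {0..})"
proof -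
  have "L-lipschitz_on {0..} f"
    using L lip by (auto simp: lipschitz_on_def dist_real_def)
  then show ?thesis
    by (intro borel_measurable_continuous_on_restrict lipschitz_on_continuous_on)
qed

text \<open>By invariance, the Laplace transform of \<open>\<pi>\<close> is for every \<open>t\<close> the \<open>\<pi>\<close>-average of those of
  \<open>P t x\<close>. In the bound for the latter the starting point is damped by \<open>exp (- a * t)\<close>, so letting
  \<open>t\<close> tend to infinity removes it, although nothing is known yet about the mean of \<open>\<pi>\<close>.\<close>

lemma invariant_measure_integrable:
  fixes P :: "real \<Rightarrow> real \<Rightarrow> real measure"
  assumes inv: "invariant_prob_measure P \<pi>"
    and prob: "\<And>t x. t > 0 \<Longrightarrow> x \<ge> 0 \<Longrightarrow> prob_space (P t x)"
    and sets_P: "\<And>t x. t > 0 \<Longrightarrow> x \<ge> 0 \<Longrightarrow> sets (P t x) = sets (restrict_space borel {0..})"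
    and meas: "\<And>t A. t > 0 \<Longrightarrow> A \<in> sets (restrict_space borel {0..}) \<Longrightarrow>
      (\<lambda>x. measure (P t x) A) \<in> borel_measurable (restrict_space borel {0..})"
    and a: "a > 0" and K: "K \<ge> 0"
    and lap: "\<And>t x q. t > 0 \<Longrightarrow> x \<ge> 0 \<Longrightarrow> q > 0 \<Longrightarrow>
      ennreal (exp (- q * (K + x * exp (- a * t)))) \<le> (\<integral>\<^sup>+z. ennreal (exp (- q * z)) \<partial>P t x)"
  shows "integrable \<pi> (\<lambda>z. z)"
proof -
  define S where "S = restrict_space (borel :: real measure) {0..}"
  interpret prob_space \<pi> using inv by (simp add: invariant_prob_measure_def)
  have sets_pi [measurable_cong]: "sets \<pi> = sets S" using inv by (simp add: invariant_prob_measure_def S_def)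
  have space_pi: "space \<pi> = {0..}"
    using sets_eq_imp_space_eq[OF sets_pi] by (simp add: S_def space_restrict_space)
  have id: "(\<lambda>z. z) \<in> borel_measurable S"
    unfolding S_def by (rule measurable_restrict_space1) simp
  then have [measurable]: "(\<lambda>z. z) \<in> borel_measurable \<pi>"
    by (simp cong: measurable_cong_sets)
  have bound: "exp (- q * K) \<le> (LINT z|\<pi>. exp (- q * z))" if q: "q > 0" for q
  proof -
    let ?L = "LINT z|\<pi>. exp (- q * z)"
    have int: "integrable \<pi> (\<lambda>z. exp (- q * z))"
      using q by (intro integrable_const_bound[where B=1]) (auto simp: space_pi)
    have f: "(\<lambda>z. ennreal (exp (- q * z))) \<in> borel_measurable S"
      using id by measurable
    have step: "(LINT x|\<pi>. exp (- q * (K + x * exp (- a * t)))) \<le> ?L" if t: "t > 0" for t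
    proof -
      \<comment> \<open>Invariance is given on sets; as \<open>\<pi> \<bind> P t = \<pi>\<close> it extends to integrals.\<close>
      have kern: "P t \<in> \<pi> \<rightarrow>\<^sub>M subprob_algebra S"
      proof (rule measurable_subprob_algebra)
        fix x assume "x \<in> space \<pi>"
        then have x: "x \<ge> 0" by (simp add: space_pi)
        show "subprob_space (P t x)" by (rule prob_space_imp_subprob_space[OF prob[OF t x]])
        show "sets (P t x) = sets S" unfolding S_def by (rule sets_P[OF t x])
      next
        fix A assume A: "A \<in> sets S"
        have "(\<lambda>x. ennreal (measure (P t x) A)) \<in> borel_measurable \<pi>"
          using meas[OF t A[unfolded S_def]] unfolding S_def[symmetric] by measurable
        then show "(\<lambda>x. emeasure (P t x) A) \<in> borel_measurable \<pi>"
          by (rule measurable_cong[THEN iffD1, rotated])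
             (use prob[OF t] in \<open>simp add: space_pi finite_measure.emeasure_eq_measure prob_space_def\<close>)
      qed
      have bind: "\<pi> \<bind> P t = \<pi>"
      proof (rule measure_eqI)
        show sets: "sets (\<pi> \<bind> P t) = sets \<pi>"
          unfolding sets_pi by (rule sets_bind_measurable[OF kern]) (simp add: not_empty)
        fix A assume "A \<in> sets (\<pi> \<bind> P t)"
        then have A: "A \<in> sets \<pi>" using sets by simp
        have "emeasure (\<pi> \<bind> P t) A = (\<integral>\<^sup>+x. emeasure (P t x) A \<partial>\<pi>)"
          by (rule emeasure_bind[OF _ kern]) (use A sets_pi in \<open>simp_all add: not_empty\<close>)
        also have "\<dots> = emeasure \<pi> A"
          using inv A t by (auto simp: invariant_prob_measure_def)
        finally show "emeasure (\<pi> \<bind> P t) A = emeasure \<pi> A" .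
      qed
      have int': "integrable \<pi> (\<lambda>x. exp (- q * (K + x * exp (- a * t))))"
        using q K by (intro integrable_const_bound[where B=1]) (auto simp: space_pi)
      have "ennreal (LINT x|\<pi>. exp (- q * (K + x * exp (- a * t))))
          = (\<integral>\<^sup>+x. ennreal (exp (- q * (K + x * exp (- a * t)))) \<partial>\<pi>)"
        by (rule nn_integral_eq_integral[OF int', symmetric]) simp
      also have "\<dots> \<le> (\<integral>\<^sup>+x. (\<integral>\<^sup>+z. ennreal (exp (- q * z)) \<partial>P t x) \<partial>\<pi>)"
        by (intro nn_integral_mono lap t q) (simp add: space_pi)
      also have "\<dots> = (\<integral>\<^sup>+z. ennreal (exp (- q * z)) \<partial>(\<pi> \<bind> P t))"
        by (rule nn_integral_bind[OF f kern, symmetric])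
      also have "\<dots> = ennreal ?L"
        unfolding bind by (rule nn_integral_eq_integral[OF int]) simp
      finally show ?thesis by (simp add: integral_nonneg_AE)
    qed
    have "(\<lambda>n. LINT x|\<pi>. exp (- q * (K + x * exp (- a * real (Suc n))))) \<longlonglongrightarrow> (LINT x|\<pi>. exp (- q * K))"
    proof (rule integral_dominated_convergence[where w = "\<lambda>_. 1"])
      have "filterlim (\<lambda>n. - a * real (Suc n)) at_bot sequentially"
        by (rule filterlim_tendsto_neg_mult_at_bot[OF tendsto_const _
              filterlim_compose[OF filterlim_real_sequentially filterlim_Suc]])
           (use a in simp)
      from filterlim_compose[OF exp_at_bot this]
      have "(\<lambda>n. exp (- q * (K + x * exp (- a * real (Suc n))))) \<longlonglongrightarrow> exp (- q * (K + x * 0))" for x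
        by (intro tendsto_intros)
      then show "AE x in \<pi>. (\<lambda>n. exp (- q * (K + x * exp (- a * real (Suc n))))) \<longlonglongrightarrow> exp (- q * K)"
        by simp
      show "AE x in \<pi>. norm (exp (- q * (K + x * exp (- a * real (Suc n))))) \<le> 1" for n
        using q K by (intro AE_I2) (simp add: space_pi)
    qed simp_all
    then have "(LINT x|\<pi>. exp (- q * K)) \<le> ?L"
      by (rule LIMSEQ_le_const2) (use step in \<open>auto simp del: of_nat_Suc\<close>)
    then show ?thesis by (simp add: prob_space)
  qed
  show ?thesis
    by (rule integrable_of_laplace_lower_bound[OF prob_space_axioms _ _ K bound]) (simp_all add: space_pi)
qed

text \<open>Invariance writes \<open>\<pi>\<close> as the \<open>\<pi>\<close>-mixture of the laws \<open>P t y\<close>, so its distance to \<open>P t x\<close> is at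
  most the average over \<open>y\<close> of \<open>L * \<bar>x - y\<bar> \<le> L * (x + y)\<close>.\<close>

lemma tv_norm_invariant_le:
  fixes P :: "real \<Rightarrow> real \<Rightarrow> real measure"
  assumes inv: "invariant_prob_measure P \<pi>"
    and prob: "\<And>x. x \<ge> 0 \<Longrightarrow> prob_space (P t x)"
    and t: "t \<ge> 0" and L: "L \<ge> 0"
    and lip: "\<And>x y A. x \<ge> 0 \<Longrightarrow> y \<ge> 0 \<Longrightarrow> A \<in> sets (restrict_space borel {0..}) \<Longrightarrow>
      \<bar>measure (P t x) A - measure (P t y) A\<bar> \<le> L * \<bar>x - y\<bar>"
    and int: "integrable \<pi> (\<lambda>z. z)" and x: "x \<ge> 0"
  shows "tv_norm (\<lambda>A. measure (P t x) A - measure \<pi> A) \<le> L * (x + (LINT z|\<pi>. z))"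
  unfolding tv_norm_def
proof (rule cSUP_least)
  show "sets (restrict_space borel {0..}) \<noteq> ({} :: real set set)"
    using sets.empty_sets by blast
  fix A :: "real set" assume A: "A \<in> sets (restrict_space borel {0..})"
  interpret prob_space \<pi> using inv by (simp add: invariant_prob_measure_def)
  have sets_pi: "sets \<pi> = sets (restrict_space borel {0..})" using inv by (simp add: invariant_prob_measure_def)
  have space_pi: "space \<pi> = {0..}"
    using sets_eq_imp_space_eq[OF sets_pi] by (simp add: space_restrict_space)
  let ?p = "\<lambda>y. measure (P t y) A"
  have "?p \<in> borel_measurable (restrict_space borel {0..})"
    by (rule lipschitz_half_line_measurable[OF L]) (rule lip[OF _ _ A])
  then have p: "?p \<in> borel_measurable \<pi>"
    using sets_pi by (simp cong: measurable_cong_sets)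
  have int_p: "integrable \<pi> ?p"
    using p prob by (intro integrable_const_bound[where B=1]) (auto simp: space_pi prob_space.prob_le_1)
  have "ennreal (measure \<pi> A) = (\<integral>\<^sup>+y. emeasure (P t y) A \<partial>\<pi>)"
    using inv t A unfolding emeasure_eq_measure[symmetric] by (simp add: invariant_prob_measure_def)
  also have "\<dots> = (\<integral>\<^sup>+y. ennreal (?p y) \<partial>\<pi>)"
    using prob by (intro nn_integral_cong) (simp add: space_pi finite_measure.emeasure_eq_measure prob_space_def)
  also have "\<dots> = ennreal (LINT y|\<pi>. ?p y)"
    by (rule nn_integral_eq_integral[OF int_p]) simp
  finally have "measure \<pi> A = (LINT y|\<pi>. ?p y)"
    by (simp add: integral_nonneg_AE)
  then have "?p x - measure \<pi> A = (LINT y|\<pi>. ?p x - ?p y)"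
    using int_p by (simp add: prob_space)
  also have "\<bar>\<dots>\<bar> \<le> (LINT y|\<pi>. \<bar>?p x - ?p y\<bar>)"
    by (rule integral_abs_bound)
  also have "\<dots> \<le> (LINT y|\<pi>. L * (x + y))"
  proof (rule integral_mono)
    fix y assume "y \<in> space \<pi>"
    then have y: "y \<ge> 0" by (simp add: space_pi)
    have "\<bar>?p x - ?p y\<bar> \<le> L * \<bar>x - y\<bar>" by (rule lip[OF x y A])
    also have "\<dots> \<le> L * (x + y)" using L x y by (intro mult_left_mono) auto
    finally show "\<bar>?p x - ?p y\<bar> \<le> L * (x + y)" .
  qed (use int_p int in simp_all)
  also have "\<dots> = L * (x + (LINT z|\<pi>. z))"
    using int by (simp add: prob_space)
  finally show "\<bar>?p x - measure \<pi> A\<bar> \<le> L * (x + (LINT z|\<pi>. z))" .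
qed

lemma tv_norm_prob_le_1:
  assumes "prob_space M" "prob_space N"
  shows "tv_norm (\<lambda>A. measure M A - measure N A) \<le> 1"
  unfolding tv_norm_def
proof (rule cSUP_least)
  show "sets (restrict_space borel {0..}) \<noteq> ({} :: real set set)"
    using sets.empty_sets by blast
  fix A :: "real set"
  show "\<bar>measure M A - measure N A\<bar> \<le> 1"
    using prob_space.prob_le_1[OF assms(1), of A] prob_space.prob_le_1[OF assms(2), of A]
      measure_nonneg[of M A] measure_nonneg[of N A] by linarith
qed

section \<open>Exponential ergodicity\<close>

theorem theorem4p3:
  fixes M :: "'a measure" and F :: "real \<Rightarrow> 'a measure"
    and W J :: "real \<Rightarrow> 'a \<Rightarrow> real" and X :: "real \<Rightarrow> real \<Rightarrow> 'a \<Rightarrow> real"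
    and a \<theta> \<sigma> :: real and \<nu> \<pi> :: "real measure"
  assumes params: "a > 0" "\<sigma> > 0" "\<theta> \<ge> 0"
    and levy: "levy_measure \<nu>" "emeasure \<nu> {..0} = 0"
      "(\<integral>\<^sup>+ \<xi>\<in>{0<..}. ennreal (min \<xi> 1) \<partial>\<nu>) < \<infinity>"
    and space: "filtered_prob_space M F"
    and noise: "brownian_motion M F W" "pure_jump_levy_process M F \<nu> J" "indep_processes M W J"
    and solution: "\<And>x. x \<ge> 0 \<Longrightarrow> jcir_solution M F a \<theta> \<sigma> W J x (X x)"
    and law: "\<And>x t u. x \<ge> 0 \<Longrightarrow> t \<ge> 0 \<Longrightarrow> Re u \<le> 0 \<Longrightarrow>
      (LINT \<omega>|M. exp (u * of_real (X x t \<omega>))) = jcir_transform a \<theta> \<sigma> \<nu> t x u"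
    and big_jumps: "(\<integral>\<^sup>+ \<xi>\<in>{1<..}. ennreal \<xi> \<partial>\<nu>) < \<infinity>"
    and small_jumps: "(\<integral>\<^sup>+ \<xi>\<in>{0<..<1}. ennreal (\<xi> * ln (1 / \<xi>)) \<partial>\<nu>) < \<infinity>"
    and invariant: "invariant_prob_measure (transition_kernel M X) \<pi>"
  shows "\<exists>\<beta> B. 0 < \<beta> \<and> \<beta> < 1 \<and> 0 < B \<and>
    (\<forall>t\<ge>0. \<forall>x\<ge>0.
       tv_norm (\<lambda>A. measure (transition_kernel M X t x) A - measure \<pi> A) \<le> B * (x + 1) * \<beta> powr t)"
proof -
  interpret prob_space M using space by (simp add: filtered_prob_space_def)
  interpret pi: prob_space \<pi> using invariant by (simp add: invariant_prob_measure_def)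
  have X_meas [measurable]: "X x t \<in> borel_measurable M" if "x \<ge> 0" "t \<ge> 0" for x t
  proof -
    have "X x t \<in> borel_measurable (F t)"
      using solution[OF that(1)] that(2) by (simp add: jcir_solution_def adapted_def)
    moreover have "subalgebra M (F t)"
      using space that(2) by (simp add: filtered_prob_space_def)
    ultimately show ?thesis by (metis measurable_from_subalg)
  qed
  have X_nonneg: "AE \<omega> in M. 0 \<le> X x t \<omega>" if "x \<ge> 0" "t \<ge> 0" for x t
    using solution[OF that(1)] that(2) by (auto simp: jcir_solution_def elim: AE_mp)
  have kernel_measure: "measure (transition_kernel M X t x) A = measure (distr M borel (X x t)) A"
    if "A \<in> sets (restrict_space borel {0..})" for t x A
    using that sets.sets_into_space[OF that] unfolding transition_kernel_def
    by (intro measure_restrict_space) (auto simp: space_restrict_space)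
  have kernel_sets: "sets (transition_kernel M X t x) = sets (restrict_space borel {0..})" for t x
    by (simp add: transition_kernel_def sets_restrict_space)
  have kernel_prob: "prob_space (transition_kernel M X t x)" if "x \<ge> 0" "t \<ge> 0" for x t
  proof -
    interpret D: prob_space "distr M borel (X x t)" by (rule prob_space_distr[OF X_meas[OF that]])
    have "AE z in distr M borel (X x t). z \<in> {0..}"
      using X_nonneg[OF that] X_meas[OF that] by (subst AE_distr_iff) auto
    then have "emeasure (distr M borel (X x t)) {0..} = 1"
      by (simp add: D.emeasure_eq_1_AE)
    then show ?thesis
      unfolding transition_kernel_def by (intro prob_space_restrict_space) auto
  qed
  have jump_mean: "set_integrable \<nu> {0<..} (\<lambda>\<xi>. \<xi>)"
    unfolding set_integrable_def
  proof (rule integrableI_nonneg)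
    have [measurable_cong]: "sets \<nu> = sets borel" using levy(1) by (simp add: levy_measure_def)
    show "(\<lambda>\<xi>. indicator {0<..} \<xi> *\<^sub>R \<xi>) \<in> borel_measurable \<nu>" by measurable
    have "(\<integral>\<^sup>+\<xi>. ennreal (indicator {0<..} \<xi> *\<^sub>R \<xi>) \<partial>\<nu>)
        \<le> (\<integral>\<^sup>+\<xi>. ennreal (min \<xi> 1) * indicator {0<..} \<xi> + ennreal \<xi> * indicator {1<..} \<xi> \<partial>\<nu>)"
      by (intro nn_integral_mono) (auto split: split_indicator)
    also have "\<dots> = (\<integral>\<^sup>+\<xi>\<in>{0<..}. ennreal (min \<xi> 1) \<partial>\<nu>) + (\<integral>\<^sup>+\<xi>\<in>{1<..}. ennreal \<xi> \<partial>\<nu>)"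
      by (rule nn_integral_add) measurable
    also have "\<dots> < \<infinity>" using levy(3) big_jumps by simp
    finally show "(\<integral>\<^sup>+\<xi>. ennreal (indicator {0<..} \<xi> *\<^sub>R \<xi>) \<partial>\<nu>) < \<infinity>" .
  qed (auto split: split_indicator)
  have rate_nonneg: "branching_rate a \<sigma> t \<ge> 0" if "t > 0" for t
    using params that by (simp add: branching_rate_def)
  have lip: "\<bar>measure (transition_kernel M X t x) A - measure (transition_kernel M X t y) A\<bar>
      \<le> branching_rate a \<sigma> t * \<bar>x - y\<bar>"
    if t: "t > 0" and x: "x \<ge> 0" and y: "y \<ge> 0" and A: "A \<in> sets (restrict_space borel {0..})" for t x y A
  proof -
    have A': "A \<in> sets borel" using A by (auto simp: sets_restrict_space)
    have le: "\<bar>measure (distr M borel (X v t)) A - measure (distr M borel (X u t)) A\<bar>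
        \<le> branching_rate a \<sigma> t * (v - u)" if "0 \<le> u" "u \<le> v" for u v
      using that t
      by (intro jcir_law_lipschitz[OF prob_space_axioms _ _ params(1,2) t, where \<theta> = \<theta> and \<nu> = \<nu>] A' X_meas law) auto
    show ?thesis
      unfolding kernel_measure[OF A] using le[of x y] le[of y x] x y by (cases "x \<le> y") auto
  qed
  \<comment> \<open>\<open>K\<close> is the stationary mean: the drift level plus the mean jump mass over \<open>a\<close>.\<close>
  define K where "K = \<theta> + (LINT \<xi>:{0<..}|\<nu>. \<xi>) / a"
  have "0 \<le> (LINT \<xi>:{0<..}|\<nu>. \<xi>)"
    unfolding set_lebesgue_integral_def by (intro integral_nonneg_AE AE_I2) (simp split: split_indicator)
  then have K: "K \<ge> 0" using params by (simp add: K_def)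
  have lap: "ennreal (exp (- q * (K + x * exp (- a * t))))
      \<le> (\<integral>\<^sup>+z. ennreal (exp (- q * z)) \<partial>transition_kernel M X t x)"
    if t: "t > 0" and x: "x \<ge> 0" and q: "q > 0" for t x q
  proof -
    have t0: "t \<ge> 0" using t by simp
    note [measurable] = X_meas[OF x t0]
    have int: "integrable M (\<lambda>\<omega>. exp (- q * X x t \<omega>))"
      using X_nonneg[OF x t0] q by (intro integrable_const_bound[where B=1]) (auto elim!: eventually_mono)
    have "complex_of_real (LINT \<omega>|M. exp (- q * X x t \<omega>)) = (LINT \<omega>|M. exp (- of_real q * of_real (X x t \<omega>)))"
      by (simp flip: integral_complex_of_real exp_of_real)
    also have "\<dots> = jcir_transform a \<theta> \<sigma> \<nu> t x (- of_real q)"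
      using q x t by (intro law) auto
    finally have "exp (- q * (K + x * exp (- a * t))) \<le> (LINT \<omega>|M. exp (- q * X x t \<omega>))"
      using jcir_laplace_lower_bound[OF params q t0 x jump_mean] unfolding K_def by (metis Re_complex_of_real)
    then have "ennreal (exp (- q * (K + x * exp (- a * t)))) \<le> ennreal (LINT \<omega>|M. exp (- q * X x t \<omega>))"
      by (rule ennreal_leI)
    also have "\<dots> = (\<integral>\<^sup>+\<omega>. ennreal (exp (- q * X x t \<omega>)) \<partial>M)"
      by (rule nn_integral_eq_integral[OF int, symmetric]) simp
    also have "\<dots> = (\<integral>\<^sup>+\<omega>. ennreal (exp (- q * X x t \<omega>)) * indicator {0..} (X x t \<omega>) \<partial>M)"
      using X_nonneg[OF x t0] by (intro nn_integral_cong_AE) (auto elim!: eventually_mono)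
    also have "\<dots> = (\<integral>\<^sup>+z. ennreal (exp (- q * z)) \<partial>transition_kernel M X t x)"
      unfolding transition_kernel_def by (subst nn_integral_restrict_space) (simp_all add: nn_integral_distr)
    finally show ?thesis .
  qed
  have pi_mean: "integrable \<pi> (\<lambda>z. z)"
  proof (rule invariant_measure_integrable[OF invariant _ _ _ params(1) K lap])
    show "(\<lambda>x. measure (transition_kernel M X t x) A) \<in> borel_measurable (restrict_space borel {0..})"
      if "t > 0" "A \<in> sets (restrict_space borel {0..})" for t A
      by (rule lipschitz_half_line_measurable[OF rate_nonneg[OF that(1)]]) (rule lip[OF that(1) _ _ that(2)])
  qed (simp_all add: kernel_prob kernel_sets)
  define m where "m = (LINT z|\<pi>. z)"
  have "space \<pi> = {0..}"
    using invariant sets_eq_imp_space_eq[of \<pi>] by (simp add: invariant_prob_measure_def space_restrict_space)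
  then have m: "m \<ge> 0" unfolding m_def by (intro integral_nonneg_AE AE_I2) simp
  \<comment> \<open>For \<open>t \<ge> 1\<close> the rate is at most \<open>C * exp (- a * t)\<close>. It blows up as \<open>t\<close> tends to \<open>0\<close>, and for
    \<open>t < 1\<close> the trivial bound \<open>1\<close> is absorbed by the summand \<open>exp a\<close> of \<open>B\<close>.\<close>
  define C where "C = 1 / (\<sigma>\<^sup>2 / (2 * a) * (1 - exp (- a)))"
  have C: "C > 0" using params by (simp add: C_def)
  define B where "B = exp a + C * (1 + m)"
  have powr: "exp (- a) powr t = exp (- a * t)" for t
    by (simp add: powr_def)
  have bound: "tv_norm (\<lambda>A. measure (transition_kernel M X t x) A - measure \<pi> A) \<le> B * (x + 1) * exp (- a) powr t"
    if t: "t \<ge> 0" and x: "x \<ge> 0" for t x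
  proof (cases "t \<ge> 1")
    case True
    then have t: "t > 0" by simp
    have "tv_norm (\<lambda>A. measure (transition_kernel M X t x) A - measure \<pi> A) \<le> branching_rate a \<sigma> t * (x + m)"
      unfolding m_def
      by (rule tv_norm_invariant_le[OF invariant _ _ rate_nonneg[OF t] lip[OF t] pi_mean x])
         (use t in \<open>simp_all add: kernel_prob\<close>)
    also have "\<dots> \<le> (C * exp (- a * t)) * ((1 + m) * (x + 1))"
    proof (intro mult_mono)
      have "exp (- a * t) / (\<sigma>\<^sup>2 / (2 * a) * (1 - exp (- a * t))) \<le> exp (- a * t) / (\<sigma>\<^sup>2 / (2 * a) * (1 - exp (- a)))"
        using params True by (intro divide_left_mono mult_left_mono mult_pos_pos) auto
      then show "branching_rate a \<sigma> t \<le> C * exp (- a * t)"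
        by (simp add: branching_rate_def C_def mult_ac)
      show "x + m \<le> (1 + m) * (x + 1)" using x m by (simp add: algebra_simps)
    qed (use C x m in auto)
    also have "\<dots> = (C * (1 + m)) * ((x + 1) * exp (- a * t))"
      by (simp only: mult_ac)
    also have "\<dots> \<le> B * ((x + 1) * exp (- a * t))"
      using x by (intro mult_right_mono) (simp_all add: B_def)
    finally show ?thesis by (simp only: powr mult.assoc)
  next
    case False
    have "tv_norm (\<lambda>A. measure (transition_kernel M X t x) A - measure \<pi> A) \<le> 1"
      by (rule tv_norm_prob_le_1[OF kernel_prob[OF x t] pi.prob_space_axioms])
    also have "1 \<le> exp (a * (1 - t))"
      using False params by simp
    also have "\<dots> = exp a * exp (- a * t)"
      by (simp add: exp_add[symmetric] algebra_simps)
    also have "\<dots> \<le> B * (x + 1) * exp (- a * t)"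
    proof (rule mult_right_mono)
      have "exp a * 1 \<le> B * (x + 1)"
        using C m x by (intro mult_mono) (auto simp: B_def)
      then show "exp a \<le> B * (x + 1)" by simp
    qed simp
    finally show ?thesis by (simp only: powr)
  qed
  have "B > 0" using C m by (simp add: B_def add_pos_nonneg)
  with bound params show ?thesis
    by (intro exI[of _ "exp (- a)"] exI[of _ B]) auto
qed

end
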